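(* There is an algorithm that, given an $n$-vertex $d$-degenerated undirected graph $G$, runs in time $O(dn\log n)$ and outputs a dominating set of $G$ whose size is at most $d^2$ times the size of a minimum dominating set of $G$.
   Context: A dominating set of $G=(V,E)$ is a set $S\subseteq V$ such that every vertex is in $S$ or adjacent to a vertex of $S$. $G$ is $d$-degenerated if every subgraph of $G$ has a vertex of degree at most $d$.
   Formalization: The formal statement assumes d ≥ 1: for d = 0 the claim fails on every nonempty edgeless graph, whose minimum dominating set is nonempty while d² times its size is 0. The time bound is stated for n ≥ 2, where log n is positive. *)

theory Defs
  imports Complex_Main
begin

section \<open>Graphs, dominating sets, degeneracy\<close>

definition simple_graph :: "'a set \<Rightarrow> 'a set set \<Rightarrow> bool" where
  "simple_graph V E \<longleftrightarrow> finite V \<and> (\<forall>e\<in>E. e \<subseteq> V \<and> card e = 2)"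

definition subgraph :: "'a set \<Rightarrow> 'a set set \<Rightarrow> 'a set \<Rightarrow> 'a set set \<Rightarrow> bool" where
  "subgraph V' E' V E \<longleftrightarrow> simple_graph V' E' \<and> V' \<subseteq> V \<and> E' \<subseteq> E"

definition degree :: "'a set set \<Rightarrow> 'a \<Rightarrow> nat" where
  "degree E v = card {e \<in> E. v \<in> e}"

definition degenerate :: "nat \<Rightarrow> 'a set \<Rightarrow> 'a set set \<Rightarrow> bool" where
  "degenerate d V E \<longleftrightarrow>
     (\<forall>V' E'. subgraph V' E' V E \<and> V' \<noteq> {} \<longrightarrow> (\<exists>v\<in>V'. degree E' v \<le> d))"

definition dominating_set :: "'a set \<Rightarrow> 'a set set \<Rightarrow> 'a set \<Rightarrow> bool" where
  "dominating_set V E S \<longleftrightarrow> S \<subseteq> V \<and> (\<forall>v\<in>V. v \<in> S \<or> (\<exists>u\<in>S. {u, v} \<in> E))"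

definition domination_number :: "'a set \<Rightarrow> 'a set set \<Rightarrow> nat" where
  "domination_number V E = Min (card ` {S. dominating_set V E S})"


section \<open>A random access machine language with unit-cost operations\<close>

text \<open>
  Algorithms are programs of a while language over natural-number scalar variables and
  arrays. The names of scalars and arrays are fixed in the program text; array indices are
  computed, which gives indirect addressing. The arithmetic is that of the usual uniform-cost
  random access machine: addition and truncated subtraction, but no multiplication or shifts.
\<close>

datatype exp =
    Num nat
  | Var nat
  | Read nat exp
  | Plus exp exp
  | Minus exp exp

datatype bexp =
    Less exp exp
  | Equal exp exp
  | Neg bexp
  | Conj bexp bexp

datatype com =
    Skip
  | Assign nat exp
  | Write nat exp exp
  | Seq com com
  | Cond bexp com com
  | While bexp com

record state =
  scalars :: "nat \<Rightarrow> nat"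
  arrays :: "nat \<Rightarrow> nat \<Rightarrow> nat"

primrec eval :: "state \<Rightarrow> exp \<Rightarrow> nat" where
  "eval s (Num k) = k"
| "eval s (Var x) = scalars s x"
| "eval s (Read a e) = arrays s a (eval s e)"
| "eval s (Plus e f) = eval s e + eval s f"
| "eval s (Minus e f) = eval s e - eval s f"

primrec beval :: "state \<Rightarrow> bexp \<Rightarrow> bool" where
  "beval s (Less e f) \<longleftrightarrow> eval s e < eval s f"
| "beval s (Equal e f) \<longleftrightarrow> eval s e = eval s f"
| "beval s (Neg b) \<longleftrightarrow> \<not> beval s b"
| "beval s (Conj b c) \<longleftrightarrow> beval s b \<and> beval s c"

primrec ecost :: "exp \<Rightarrow> nat" where
  "ecost (Num k) = 1"
| "ecost (Var x) = 1"
| "ecost (Read a e) = 1 + ecost e"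
| "ecost (Plus e f) = 1 + ecost e + ecost f"
| "ecost (Minus e f) = 1 + ecost e + ecost f"

primrec bcost :: "bexp \<Rightarrow> nat" where
  "bcost (Less e f) = 1 + ecost e + ecost f"
| "bcost (Equal e f) = 1 + ecost e + ecost f"
| "bcost (Neg b) = 1 + bcost b"
| "bcost (Conj b c) = 1 + bcost b + bcost c"

text \<open>\<open>exec c s t s'\<close>: started in \<open>s\<close>, the program \<open>c\<close> halts in \<open>s'\<close> after \<open>t\<close> elementary steps.\<close>

inductive exec :: "com \<Rightarrow> state \<Rightarrow> nat \<Rightarrow> state \<Rightarrow> bool" where
  Skip: "exec Skip s 1 s"
| Assign: "exec (Assign x e) s (1 + ecost e) (s\<lparr>scalars := (scalars s)(x := eval s e)\<rparr>)"
| Write: "exec (Write a i e) s (1 + ecost i + ecost e)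
    (s\<lparr>arrays := (arrays s)(a := (arrays s a)(eval s i := eval s e))\<rparr>)"
| Seq: "exec c1 s t1 s' \<Longrightarrow> exec c2 s' t2 s'' \<Longrightarrow> exec (Seq c1 c2) s (t1 + t2) s''"
| CondTrue: "beval s b \<Longrightarrow> exec c1 s t s' \<Longrightarrow> exec (Cond b c1 c2) s (1 + bcost b + t) s'"
| CondFalse: "\<not> beval s b \<Longrightarrow> exec c2 s t s' \<Longrightarrow> exec (Cond b c1 c2) s (1 + bcost b + t) s'"
| WhileFalse: "\<not> beval s b \<Longrightarrow> exec (While b c) s (1 + bcost b) s"
| WhileTrue: "beval s b \<Longrightarrow> exec c s t1 s' \<Longrightarrow> exec (While b c) s' t2 s'' \<Longrightarrow>
    exec (While b c) s (1 + bcost b + t1 + t2) s''"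

inductive_cases SkipE: "exec Skip s t s'"
inductive_cases AssignE: "exec (Assign x e) s t s'"
inductive_cases WriteE: "exec (Write a i e) s t s'"
inductive_cases SeqE: "exec (Seq c1 c2) s t s'"
inductive_cases CondE: "exec (Cond b c1 c2) s t s'"
inductive_cases WhileE: "exec (While b c) s t s'"

lemma exec_deterministic:
  "exec c s t s' \<Longrightarrow> exec c s u s'' \<Longrightarrow> u = t \<and> s'' = s'"
proof (induction arbitrary: u s'' rule: exec.induct)
  case (Skip s)
  from Skip.prems show ?case by (rule SkipE) simp
next
  case (Assign x e s)
  from Assign.prems show ?case by (rule AssignE) simp
next
  case (Write a i e s)
  from Write.prems show ?case by (rule WriteE) simp
next
  case (Seq c1 s t1 s1 c2 t2 s2)
  from Seq.prems show ?case
  proof (rule SeqE)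
    fix v1 r v2
    assume "u = v1 + v2" and 1: "exec c1 s v1 r" and 2: "exec c2 r v2 s''"
    moreover have "v1 = t1 \<and> r = s1" using Seq.IH(1)[OF 1] .
    moreover from this have "v2 = t2 \<and> s'' = s2" using Seq.IH(2)[of v2 s''] 2 by simp
    ultimately show ?thesis by simp
  qed
next
  case (CondTrue s b c1 t s' c2)
  from CondTrue.prems show ?case
  proof (rule CondE)
    fix v assume "u = Suc (bcost b + v)" "exec c1 s v s''"
    with CondTrue.IH[of v s''] show ?thesis by simp
  qed (use CondTrue.hyps in simp)
next
  case (CondFalse s b c2 t s' c1)
  from CondFalse.prems show ?case
  proof (rule CondE)
    fix v assume "u = Suc (bcost b + v)" "exec c2 s v s''"
    with CondFalse.IH[of v s''] show ?thesis by simp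
  qed (use CondFalse.hyps in simp)
next
  case (WhileFalse s b c)
  from WhileFalse.prems show ?case
    by (rule WhileE) (use WhileFalse.hyps in simp_all)
next
  case (WhileTrue s b c t1 s1 t2 s2)
  from WhileTrue.prems show ?case
  proof (rule WhileE)
    fix v1 r v2
    assume "u = Suc (bcost b + v1 + v2)" and 1: "exec c s v1 r" and 2: "exec (While b c) r v2 s''"
    moreover have "v1 = t1 \<and> r = s1" using WhileTrue.IH(1)[OF 1] .
    moreover from this have "v2 = t2 \<and> s'' = s2" using WhileTrue.IH(2)[of v2 s''] 2 by simp
    ultimately show ?thesis by simp
  qed (use WhileTrue.hyps in simp)
qed


section \<open>Encoding of the input and the output\<close>

text \<open>
  The vertices of an \<open>n\<close>-vertex input graph are numbered \<open>0, \<dots>, n - 1\<close>. The graph is given by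
  adjacency lists, in which the neighbours of a vertex may appear in any order.
\<close>

definition adjacency_lists :: "nat \<Rightarrow> nat set set \<Rightarrow> nat list list \<Rightarrow> bool" where
  "adjacency_lists n E adj \<longleftrightarrow> length adj = n \<and>
     (\<forall>v<n. distinct (adj ! v) \<and> set (adj ! v) = {u. {u, v} \<in> E})"

text \<open>
  Scalar 0 holds \<open>n\<close>. Array 1 holds the concatenation of the adjacency lists, in which the
  list of vertex \<open>v\<close> occupies the positions from \<open>off v\<close> to \<open>off (v + 1) - 1\<close>, where array 0
  holds the offsets \<open>off 0, \<dots>, off n\<close>. The rest of the memory is zero.
\<close>

definition input_state :: "nat \<Rightarrow> nat list list \<Rightarrow> state" where
  "input_state n adj = \<lparr>
     scalars = (\<lambda>_. 0)(0 := n),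
     arrays = (\<lambda>_ _. 0)
       (0 := (\<lambda>v. if v \<le> n then length (concat (take v adj)) else 0),
        1 := (\<lambda>i. if i < length (concat adj) then concat adj ! i else 0))\<rparr>"

text \<open>The output is the characteristic vector of a vertex set, in the first \<open>n\<close> cells of array 2.\<close>

definition output_set :: "nat \<Rightarrow> state \<Rightarrow> nat set" where
  "output_set n s = {v. v < n \<and> arrays s 2 v \<noteq> 0}"

end

theory Submission
  imports Defs
begin

text \<open>
  Remove the vertices one by one, always taking a vertex \<open>v\<close> with at most \<open>k\<close> remaining neighbours,
  where \<open>k\<close> starts at 0 and grows by 1 only if no such vertex exists; degeneracy keeps \<open>k \<le> d\<close>.
  If \<open>v\<close> is not yet dominated when it is removed, pick \<open>v\<close> and add all its remaining neighbours
  to the output (or \<open>v\<close> itself, if there are none). Each pick adds at most \<open>d\<close> vertices. Moreover at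
  most \<open>d\<close> picks lie in the closed neighbourhood of any vertex \<open>x\<close>: the first pick that is a
  neighbour of \<open>x\<close> removed before \<open>x\<close> puts \<open>x\<close> into the output; if \<open>x\<close> itself is picked, its remaining
  neighbours are put into the output; otherwise all these picks are among the at most \<open>d\<close> neighbours
  remaining when \<open>x\<close> is removed. So there are at most \<open>d\<close> picks per vertex of an optimal solution.
  Searching all vertices again for each value of \<open>k\<close> costs \<open>O(d n)\<close>, as does scanning the
  at most \<open>d n\<close> edges.
\<close>


section \<open>Degenerate graphs\<close>

lemma simple_graph_finite_edges: "simple_graph V E \<Longrightarrow> finite E"
  by (rule finite_subset[of _ "Pow V"]) (auto simp: simple_graph_def)

lemma subgraph_trans:
  "subgraph V'' E'' V' E' \<Longrightarrow> subgraph V' E' V E \<Longrightarrow> subgraph V'' E'' V E"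
  by (auto simp: subgraph_def)

lemma degenerate_subgraph:
  "degenerate d V E \<Longrightarrow> subgraph V' E' V E \<Longrightarrow> degenerate d V' E'"
  unfolding degenerate_def by (metis subgraph_trans)

lemma degenerate_card_edges_le:
  assumes "simple_graph V E" "degenerate d V E"
  shows "card E \<le> d * card V"
proof -
  have "finite V" using assms(1) by (simp add: simple_graph_def)
  then show ?thesis
    using assms
  proof (induction V arbitrary: E rule: finite_psubset_induct)
    case (psubset V)
    show ?case
    proof (cases "V = {}")
      case True
      then have "E = {}" using psubset.prems(1) by (auto simp: simple_graph_def)
      then show ?thesis by simp
    next
      case False
      have "subgraph V E V E"
        using psubset.prems(1) by (simp add: subgraph_def)
      then obtain v where v: "v \<in> V" "degree E v \<le> d"
        using psubset.prems(2) False unfolding degenerate_def by blast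
      define F where "F = {e \<in> E. v \<notin> e}"
      have F: "subgraph (V - {v}) F V E"
        using psubset.prems(1) by (auto simp: subgraph_def simple_graph_def F_def)
      have "card F \<le> d * card (V - {v})"
        using v F degenerate_subgraph[OF psubset.prems(2) F]
        by (intro psubset.IH psubsetI) (auto simp: subgraph_def)
      moreover have "F \<union> {e \<in> E. v \<in> e} = E"
        by (auto simp: F_def)
      then have "card E \<le> card F + degree E v"
        using card_Un_le[of F "{e \<in> E. v \<in> e}"] by (simp add: degree_def)
      moreover have "d * card V = d + d * card (V - {v})"
        using psubset.hyps v by (simp only: card.remove[of V v] mult_Suc_right)
      ultimately show ?thesis using v by linarith
    qed
  qed
qed

lemma sum_degree_eq:
  assumes "simple_graph V E"
  shows "(\<Sum>v\<in>V. degree E v) = 2 * card E"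
  unfolding degree_def
proof (rule sum_multicount)
  have "{v \<in> V. v \<in> e} = e" if "e \<in> E" for e
    using assms that by (auto simp: simple_graph_def)
  then show "\<forall>e\<in>E. card {v \<in> V. v \<in> e} = 2"
    using assms by (simp add: simple_graph_def)
qed (use assms simple_graph_finite_edges in \<open>auto simp: simple_graph_def\<close>)


section \<open>Neighbourhoods and domination\<close>

locale graph =
  fixes V :: "'a set" and E :: "'a set set"
  assumes simple: "simple_graph V E"
begin

definition nbs :: "'a \<Rightarrow> 'a set" where
  "nbs v = {u. {u, v} \<in> E}"

definition closed_nbs :: "'a \<Rightarrow> 'a set" where
  "closed_nbs v = insert v (nbs v)"

lemma finite_vertices: "finite V"
  using simple by (simp add: simple_graph_def)

lemma nbs_subset: "nbs v \<subseteq> V"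
  using simple by (auto simp: nbs_def simple_graph_def)

lemma finite_nbs [simp]: "finite (nbs v)"
  using nbs_subset finite_vertices by (rule finite_subset)

lemma not_in_nbs_self [simp]: "v \<notin> nbs v"
  using simple by (auto simp: nbs_def simple_graph_def)

lemma nbs_sym: "u \<in> nbs v \<longleftrightarrow> v \<in> nbs u"
  by (simp add: nbs_def insert_commute)

lemma closed_nbs_sym: "u \<in> closed_nbs v \<longleftrightarrow> v \<in> closed_nbs u"
  using nbs_sym by (auto simp: closed_nbs_def)

lemma closed_nbs_subset: "v \<in> V \<Longrightarrow> closed_nbs v \<subseteq> V"
  using nbs_subset by (auto simp: closed_nbs_def)

lemma card_nbs: "card (nbs v) = degree E v"
proof -
  have "e \<in> (\<lambda>u. {u, v}) ` nbs v" if "e \<in> E" "v \<in> e" for e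
  proof -
    obtain a b where "e = {a, b}"
      using simple \<open>e \<in> E\<close> by (auto simp: simple_graph_def card_2_iff)
    then show ?thesis using that by (auto simp: nbs_def insert_commute)
  qed
  then have "{e \<in> E. v \<in> e} = (\<lambda>u. {u, v}) ` nbs v"
    by (auto simp: nbs_def)
  moreover have "inj_on (\<lambda>u. {u, v}) (nbs v)"
    by (auto simp: inj_on_def doubleton_eq_iff)
  ultimately show ?thesis by (simp add: degree_def card_image)
qed

lemma degenerate_low_degree_vertex:
  assumes "degenerate d V E" and W: "W \<subseteq> V" "W \<noteq> {}"
  shows "\<exists>v\<in>W. card (nbs v \<inter> W) \<le> d"
proof -
  define F where "F = {e \<in> E. e \<subseteq> W}"
  have "subgraph W F V E"
    using simple W by (auto simp: subgraph_def simple_graph_def F_def intro: finite_subset)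
  then interpret induced: graph W F
    by unfold_locales (simp add: subgraph_def)
  obtain v where v: "v \<in> W" "degree F v \<le> d"
    using assms \<open>subgraph W F V E\<close> unfolding degenerate_def by blast
  have "induced.nbs v = nbs v \<inter> W"
    unfolding nbs_def induced.nbs_def using v by (auto simp: F_def)
  then show ?thesis using v induced.card_nbs by metis
qed

lemma domination_number_attained:
  obtains S where "dominating_set V E S" "card S = domination_number V E"
proof -
  have "finite {S. dominating_set V E S}"
    by (rule finite_subset[of _ "Pow V"]) (use finite_vertices in \<open>auto simp: dominating_set_def\<close>)
  moreover have "dominating_set V E V"
    by (simp add: dominating_set_def)
  ultimately have "domination_number V E \<in> card ` {S. dominating_set V E S}"
    unfolding domination_number_def by (intro Min_in) auto
  then show ?thesis using that by auto
qed

lemma card_le_mult_card_dominating_set: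
  assumes S: "dominating_set V E S" and "U \<subseteq> V"
    and load: "\<And>x. x \<in> V \<Longrightarrow> card (U \<inter> closed_nbs x) \<le> k"
  shows "card U \<le> k * card S"
proof -
  have "S \<subseteq> V" "finite S"
    using S finite_vertices by (auto simp: dominating_set_def intro: finite_subset)
  have "\<exists>x\<in>S. u \<in> closed_nbs x" if "u \<in> U" for u
  proof -
    have "u \<in> S \<or> (\<exists>x\<in>S. x \<in> nbs u)"
      using S that \<open>U \<subseteq> V\<close> by (auto simp: dominating_set_def nbs_def)
    then show ?thesis
      using nbs_sym by (auto simp: closed_nbs_def)
  qed
  then have "U = (\<Union>x\<in>S. U \<inter> closed_nbs x)" by blast
  then have "card U \<le> (\<Sum>x\<in>S. card (U \<inter> closed_nbs x))"
    using card_UN_le[OF \<open>finite S\<close>] by metis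
  also have "\<dots> \<le> of_nat (card S) * k"
    using load \<open>S \<subseteq> V\<close> by (intro sum_bounded_above) auto
  finally show ?thesis by (simp add: mult.commute)
qed


section \<open>Greedy domination along a removal order\<close>

definition recruits :: "'a set \<Rightarrow> 'a \<Rightarrow> 'a set" where
  "recruits R v = (if nbs v \<subseteq> R then {v} else nbs v - R)"

text \<open>
  In \<open>greedy d R D U\<close>, the vertices in \<open>R\<close> have been removed, \<open>D\<close> is the output so far, and \<open>U\<close> consists
  of the picks, the vertices that were undominated when they were removed.
\<close>

inductive greedy :: "nat \<Rightarrow> 'a set \<Rightarrow> 'a set \<Rightarrow> 'a set \<Rightarrow> bool" for d where
  empty: "greedy d {} {} {}"
| dominated: "greedy d R D U \<Longrightarrow> v \<in> V - R \<Longrightarrow> card (nbs v - R) \<le> d \<Longrightarrow>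
    closed_nbs v \<inter> D \<noteq> {} \<Longrightarrow> greedy d (insert v R) D U"
| pick: "greedy d R D U \<Longrightarrow> v \<in> V - R \<Longrightarrow> card (nbs v - R) \<le> d \<Longrightarrow>
    closed_nbs v \<inter> D = {} \<Longrightarrow> greedy d (insert v R) (D \<union> recruits R v) (insert v U)"

lemma recruits_subset_closed_nbs: "recruits R v \<subseteq> closed_nbs v"
  by (auto simp: recruits_def closed_nbs_def)

lemma recruits_subset: "v \<in> V \<Longrightarrow> recruits R v \<subseteq> V"
  using recruits_subset_closed_nbs closed_nbs_subset by (rule order_trans)

lemma recruits_nonempty: "recruits R v \<noteq> {}"
  by (auto simp: recruits_def)

lemma remaining_nbs_subset_recruits: "nbs v - R \<subseteq> recruits R v"
  by (auto simp: recruits_def)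

lemma greedy_subset:
  assumes "greedy d R D U"
  shows "R \<subseteq> V" "D \<subseteq> V" "U \<subseteq> R"
  using assms by (induction rule: greedy.induct) (use recruits_subset in auto)

lemma greedy_finite_picks: "greedy d R D U \<Longrightarrow> finite U"
  by (induction rule: greedy.induct) auto

lemma greedy_dominates: "greedy d R D U \<Longrightarrow> r \<in> R \<Longrightarrow> closed_nbs r \<inter> D \<noteq> {}"
proof (induction rule: greedy.induct)
  case (pick R D U v)
  then show ?case
    using recruits_subset_closed_nbs[of R v] recruits_nonempty[of R v] by blast
qed auto

lemma greedy_card_output_le:
  assumes "greedy d R D U" "d \<ge> 1"
  shows "card D \<le> d * card U"
  using assms(1)
proof (induction rule: greedy.induct)
  case (pick R D U v)
  have "card (recruits R v) \<le> d"
    using pick.hyps \<open>d \<ge> 1\<close> by (simp add: recruits_def)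
  moreover have "v \<notin> U" "finite U"
    using pick.hyps(2) greedy_subset(3)[OF pick.hyps(1)] greedy_finite_picks[OF pick.hyps(1)]
    by auto
  ultimately show ?case
    using pick.IH card_Un_le[of D "recruits R v"] by simp
qed simp_all

lemma greedy_no_picks_near_unchosen:
  assumes "greedy d R D U" "x \<notin> R" "x \<notin> D"
  shows "U \<inter> closed_nbs x = {}"
  using assms
proof (induction rule: greedy.induct)
  case (pick R D U v)
  then have "x \<notin> closed_nbs v"
    using remaining_nbs_subset_recruits by (auto simp: closed_nbs_def)
  then show ?case
    using pick closed_nbs_sym[of v x] by auto
qed auto

lemma card_remaining_insert_le:
  assumes "v \<notin> R \<union> D"
  shows "card (nbs x - insert v R - (D \<union> A)) + of_bool (v \<in> nbs x) \<le> card (nbs x - R - D)"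
proof (cases "v \<in> nbs x")
  case True
  let ?rest = "nbs x - insert v R - (D \<union> A)"
  have "card (insert v ?rest) \<le> card (nbs x - R - D)"
    using True assms by (intro card_mono) auto
  then show ?thesis using True by simp
next
  case False
  have "card (nbs x - insert v R - (D \<union> A)) \<le> card (nbs x - R - D)"
    by (intro card_mono) auto
  then show ?thesis using False by simp
qed

lemma greedy_picks_plus_remaining_le:
  assumes "greedy d R D U" "d \<ge> 1" "x \<in> R" "x \<notin> D"
  shows "card (U \<inter> closed_nbs x) + card (nbs x - R - D) \<le> d"
  using assms(1,3,4)
proof (induction rule: greedy.induct)
  case (dominated R D U v)
  show ?case
  proof (cases "x = v")
    case True
    then have "U \<inter> closed_nbs x = {}"
      using greedy_no_picks_near_unchosen dominated by blast
    moreover have "card (nbs x - insert v R - D) \<le> card (nbs x - R)"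
      by (intro card_mono) auto
    ultimately show ?thesis using dominated.hyps True by simp
  next
    case False
    have "card (nbs x - insert v R - D) \<le> card (nbs x - R - D)"
      by (intro card_mono) auto
    then show ?thesis
      using dominated.IH dominated.prems False by simp
  qed
next
  case (pick R D U v)
  have v: "v \<notin> U" "v \<notin> R" "v \<notin> D" and "finite U"
    using pick.hyps greedy_subset(3)[OF pick.hyps(1)] greedy_finite_picks
    by (auto simp: closed_nbs_def)
  show ?case
  proof (cases "x = v")
    case True
    then have "insert v U \<inter> closed_nbs x = {v}"
      using greedy_no_picks_near_unchosen[OF pick.hyps(1)] v by (auto simp: closed_nbs_def)
    moreover have "nbs x - insert v R - (D \<union> recruits R v) = {}"
      using remaining_nbs_subset_recruits True by blast
    ultimately have "card (insert v U \<inter> closed_nbs x) = 1"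
      and "card (nbs x - insert v R - (D \<union> recruits R v)) = 0"
      by (simp_all only: card.empty is_singleton_altdef[symmetric] is_singletonI)
    then show ?thesis using \<open>d \<ge> 1\<close> by linarith
  next
    case False
    then have "card (insert v U \<inter> closed_nbs x) = card (U \<inter> closed_nbs x) + of_bool (v \<in> nbs x)"
      using v \<open>finite U\<close> by (simp add: closed_nbs_def Int_insert_left)
    then show ?thesis
      using card_remaining_insert_le[of v R D x "recruits R v"] pick.IH pick.prems False v by simp
  qed
qed simp

lemma greedy_picks_near_le:
  assumes "greedy d R D U" "d \<ge> 1"
  shows "card (U \<inter> closed_nbs x) \<le> d"
  using assms(1)
proof (induction rule: greedy.induct)
  case (pick R D U v)
  consider "v \<notin> closed_nbs x" | "v \<in> closed_nbs x" "x \<notin> R" | "v \<in> nbs x" "x \<in> R"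
    using pick.hyps by (auto simp: closed_nbs_def)
  then show ?case
  proof cases
    assume "v \<notin> closed_nbs x"
    then show ?thesis using pick.IH by simp
  next
    assume x: "v \<in> closed_nbs x" "x \<notin> R"
    then have "x \<notin> D" using pick.hyps closed_nbs_sym by blast
    then have "U \<inter> closed_nbs x = {}"
      using greedy_no_picks_near_unchosen pick.hyps x by blast
    then show ?thesis using x \<open>d \<ge> 1\<close> by simp
  next
    assume x: "v \<in> nbs x" "x \<in> R"
    then have "x \<notin> D" using pick.hyps nbs_sym by (auto simp: closed_nbs_def)
    have "v \<in> nbs x - R - D"
      using x pick.hyps by (auto simp: closed_nbs_def)
    then have "card (nbs x - R - D) > 0"
      by (auto simp: card_gt_0_iff)
    then show ?thesis
      using greedy_picks_plus_remaining_le[OF pick.hyps(1) \<open>d \<ge> 1\<close> x(2) \<open>x \<notin> D\<close>] x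
        card_insert_le_m1[of d "U \<inter> closed_nbs x" v] by (simp add: closed_nbs_def)
  qed
qed simp_all

lemma greedy_dominating_set:
  assumes "greedy d V D U"
  shows "dominating_set V E D"
  using greedy_dominates[OF assms] greedy_subset(2)[OF assms]
  by (auto simp: dominating_set_def closed_nbs_def nbs_def)

lemma greedy_card_le_domination_number:
  assumes "greedy d V D U" "d \<ge> 1"
  shows "card D \<le> d\<^sup>2 * domination_number V E"
proof -
  obtain S where S: "dominating_set V E S" "card S = domination_number V E"
    by (rule domination_number_attained)
  have "card D \<le> d * card U"
    using greedy_card_output_le[OF assms] .
  also have "card U \<le> d * card S"
    using greedy_subset[OF assms(1)] greedy_picks_near_le[OF assms]
    by (intro card_le_mult_card_dominating_set[OF S(1)]) auto
  finally show ?thesis using S by (simp add: power2_eq_square mult.assoc)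
qed

end


section \<open>Total correctness with running times\<close>

definition wp :: "com \<Rightarrow> state \<Rightarrow> (nat \<Rightarrow> state \<Rightarrow> bool) \<Rightarrow> bool" where
  "wp c s Q \<longleftrightarrow> (\<exists>t s'. exec c s t s' \<and> Q t s')"

lemma wp_Skip: "wp Skip s Q \<longleftrightarrow> Q 1 s"
  unfolding wp_def by (metis exec.Skip exec_deterministic)

lemma wp_Assign:
  "wp (Assign x e) s Q \<longleftrightarrow> Q (1 + ecost e) (s\<lparr>scalars := (scalars s)(x := eval s e)\<rparr>)"
  unfolding wp_def by (metis exec.Assign exec_deterministic)

lemma wp_Write:
  "wp (Write a i e) s Q \<longleftrightarrow> Q (1 + ecost i + ecost e)
     (s\<lparr>arrays := (arrays s)(a := (arrays s a)(eval s i := eval s e))\<rparr>)"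
  unfolding wp_def by (metis exec.Write exec_deterministic)

lemma wp_Seq: "wp (Seq c1 c2) s Q \<longleftrightarrow> wp c1 s (\<lambda>t1 s1. wp c2 s1 (\<lambda>t2. Q (t1 + t2)))"
  unfolding wp_def by (blast intro: exec.Seq elim: SeqE)

lemma wp_Cond:
  "wp (Cond b c1 c2) s Q \<longleftrightarrow> wp (if beval s b then c1 else c2) s (\<lambda>t. Q (1 + bcost b + t))"
proof -
  have "exec (Cond b c1 c2) s t s' \<longleftrightarrow>
      (\<exists>u. t = 1 + bcost b + u \<and> exec (if beval s b then c1 else c2) s u s')" for t s'
    by (auto intro: exec.CondTrue[simplified] exec.CondFalse[simplified] elim: CondE)
  then show ?thesis unfolding wp_def by auto
qed

lemmas wp_simps = wp_Skip wp_Assign wp_Write wp_Seq wp_Cond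

lemma wp_mono: "wp c s P \<Longrightarrow> (\<And>t s'. P t s' \<Longrightarrow> Q t s') \<Longrightarrow> wp c s Q"
  unfolding wp_def by blast

text \<open>The first argument of the invariant is the time still available for the loop.\<close>

lemma wp_While:
  fixes I :: "nat \<Rightarrow> state \<Rightarrow> bool"
  assumes step: "\<And>k s. I k s \<Longrightarrow> beval s b \<Longrightarrow>
      wp c s (\<lambda>t s'. \<exists>k'. I k' s' \<and> 1 + bcost b + t + k' \<le> k)"
    and "I k s"
  shows "wp (While b c) s (\<lambda>t s'. (\<exists>k'. I k' s') \<and> \<not> beval s' b \<and> t \<le> k + 1 + bcost b)"
  using \<open>I k s\<close>
proof (induction k arbitrary: s rule: less_induct)
  case (less k)
  show ?case
  proof (cases "beval s b")
    case False
    then show ?thesis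
      using less.prems exec.WhileFalse[OF False, of c] unfolding wp_def by fastforce
  next
    case True
    then obtain t s' k' where s': "exec c s t s'" "I k' s'" "1 + bcost b + t + k' \<le> k"
      using step[OF less.prems] unfolding wp_def by blast
    then obtain u s'' where "exec (While b c) s' u s''" "\<exists>k''. I k'' s''" "\<not> beval s'' b"
        "u \<le> k' + 1 + bcost b"
      using less.IH[of k' s'] unfolding wp_def by auto
    then show ?thesis
      using exec.WhileTrue[OF True s'(1)] s'(3) unfolding wp_def by fastforce
  qed
qed


lemma wp_While_for:
  assumes step: "\<And>x s. x < m \<Longrightarrow> I x s \<Longrightarrow> beval s b \<and> wp c s (\<lambda>t s'. I (Suc x) s' \<and> t \<le> T)"
    and stop: "\<And>s. I m s \<Longrightarrow> \<not> beval s b"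
    and "I 0 s"
  shows "wp (While b c) s (\<lambda>t s'. I m s' \<and> t \<le> (m + 1) * (1 + bcost b + T))"
proof -
  define J where "J k s \<longleftrightarrow> (\<exists>x\<le>m. I x s \<and> k = (m - x) * (1 + bcost b + T))" for k s
  have "wp c s (\<lambda>t s'. \<exists>k'. J k' s' \<and> 1 + bcost b + t + k' \<le> k)" if "J k s" "beval s b" for k s
  proof -
    obtain x where x: "x < m" "I x s" "k = (m - x) * (1 + bcost b + T)"
      using \<open>J k s\<close> \<open>beval s b\<close> stop unfolding J_def by (metis order_le_less)
    let ?k' = "(m - Suc x) * (1 + bcost b + T)"
    have "k = (1 + bcost b + T) + ?k'"
      using x by (metis Suc_diff_Suc mult_Suc)
    moreover have "J ?k' s'" if "I (Suc x) s'" for s'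
      unfolding J_def using x that by (intro exI[of _ "Suc x"]) simp
    ultimately show ?thesis
      using step[OF x(1,2)] by (auto intro!: exI[of _ ?k'] elim!: wp_mono)
  qed
  moreover have "J (m * (1 + bcost b + T)) s"
    unfolding J_def using \<open>I 0 s\<close> by (intro exI[of _ 0]) simp
  ultimately have "wp (While b c) s (\<lambda>t s'. (\<exists>k'. J k' s') \<and> \<not> beval s' b \<and>
      t \<le> m * (1 + bcost b + T) + 1 + bcost b)"
    by (rule wp_While)
  then show ?thesis
    using step by (auto simp: J_def order_le_less elim!: wp_mono)
qed


section \<open>The program\<close>

abbreviation (input) vertex_count :: nat where "vertex_count \<equiv> 0"
abbreviation (input) removed_count :: nat where "removed_count \<equiv> 2"
abbreviation (input) stack_height :: nat where "stack_height \<equiv> 3"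
abbreviation (input) cursor :: nat where "cursor \<equiv> 4"
abbreviation (input) threshold :: nat where "threshold \<equiv> 5"
abbreviation (input) vertex :: nat where "vertex \<equiv> 6"
abbreviation (input) dominators :: nat where "dominators \<equiv> 7"
abbreviation (input) position :: nat where "position \<equiv> 8"
abbreviation (input) neighbour :: nat where "neighbour \<equiv> 9"

text \<open>Array 1 is written as \<open>Suc 0\<close> because the simplifier rewrites \<open>1\<close> to it.\<close>

abbreviation (input) offsets :: nat where "offsets \<equiv> 0"
abbreviation (input) adjacents :: nat where "adjacents \<equiv> Suc 0"
abbreviation (input) chosen :: nat where "chosen \<equiv> 2"
abbreviation (input) removal_flags :: nat where "removal_flags \<equiv> 3"
abbreviation (input) removed_degrees :: nat where "removed_degrees \<equiv> 4"
abbreviation (input) stack :: nat where "stack \<equiv> 5"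

notation (input) Seq (infixr ";;" 60)
notation (input) Assign (infix "::=" 65)

definition for_neighbours :: "com \<Rightarrow> com" where
  "for_neighbours body =
     position ::= Read offsets (Var vertex);;
     While (Less (Var position) (Read offsets (Plus (Var vertex) (Num 1))))
       (neighbour ::= Read adjacents (Var position);;
        body;;
        position ::= Plus (Var position) (Num 1))"

definition count_dominators :: com where
  "count_dominators =
     dominators ::= Read chosen (Var vertex);;
     for_neighbours (dominators ::= Plus (Var dominators) (Read chosen (Var neighbour)))"

definition update_neighbour :: com where
  "update_neighbour =
     Write removed_degrees (Var neighbour)
       (Plus (Read removed_degrees (Var neighbour)) (Num 1));;
     Write stack (Var stack_height) (Var neighbour);;
     stack_height ::= Plus (Var stack_height) (Num 1);;
     Cond (Conj (Equal (Var dominators) (Num 0))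
                (Equal (Read removal_flags (Var neighbour)) (Num 0)))
       (Write chosen (Var neighbour) (Num 1)) Skip"

text \<open>
  A vertex \<open>v\<close> has degree \<open>off (v + 1) - off v\<close>; its number of remaining neighbours is compared with
  0 here, and with the threshold in \<open>removable\<close>, in a form that avoids truncated subtraction.
\<close>

definition mark_removed :: com where
  "mark_removed =
     Write removal_flags (Var vertex) (Num 1);;
     removed_count ::= Plus (Var removed_count) (Num 1);;
     Cond (Conj (Equal (Var dominators) (Num 0))
                (Equal (Read offsets (Plus (Var vertex) (Num 1)))
                       (Plus (Read offsets (Var vertex)) (Read removed_degrees (Var vertex)))))
       (Write chosen (Var vertex) (Num 1)) Skip"

definition remove_vertex :: com where
  "remove_vertex = count_dominators;; for_neighbours update_neighbour;; mark_removed"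

definition pop_vertex :: com where
  "pop_vertex =
     stack_height ::= Minus (Var stack_height) (Num 1);;
     vertex ::= Read stack (Var stack_height)"

definition push_cursor :: com where
  "push_cursor =
     Write stack (Var stack_height) (Var cursor);;
     stack_height ::= Plus (Var stack_height) (Num 1);;
     cursor ::= Plus (Var cursor) (Num 1)"

definition raise_threshold :: com where
  "raise_threshold =
     threshold ::= Plus (Var threshold) (Num 1);;
     cursor ::= Num 0"

definition removable :: bexp where
  "removable =
     Conj (Equal (Read removal_flags (Var vertex)) (Num 0))
       (Less (Read offsets (Plus (Var vertex) (Num 1)))
         (Plus (Plus (Read offsets (Var vertex)) (Read removed_degrees (Var vertex)))
               (Plus (Var threshold) (Num 1))))"

definition peel_body :: com where
  "peel_body =
     Cond (Less (Num 0) (Var stack_height))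
       (pop_vertex;; Cond removable remove_vertex Skip)
       (Cond (Less (Var cursor) (Var vertex_count)) push_cursor raise_threshold)"

definition peel :: com where
  "peel = While (Less (Var removed_count) (Var vertex_count)) peel_body"


section \<open>Loops over adjacency lists\<close>

locale adjacency_input = graph "{..<n}" E for n :: nat and E :: "nat set set" +
  fixes adj :: "nat list list"
  assumes lists: "adjacency_lists n E adj"
begin

definition off :: "nat \<Rightarrow> nat" where
  "off = arrays (input_state n adj) offsets"

definition nbr :: "nat \<Rightarrow> nat" where
  "nbr = arrays (input_state n adj) adjacents"

definition input_intact :: "state \<Rightarrow> bool" where
  "input_intact s \<longleftrightarrow>
     scalars s vertex_count = n \<and> arrays s offsets = off \<and> arrays s adjacents = nbr"

definition removed :: "state \<Rightarrow> nat set" where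
  "removed s = {v. v < n \<and> arrays s removal_flags v \<noteq> 0}"

definition stacked :: "state \<Rightarrow> nat set" where
  "stacked s = arrays s stack ` {..<scalars s stack_height}"

lemma removed_subset: "removed s \<subseteq> {..<n}"
  by (auto simp: removed_def)

lemma finite_removed [simp]: "finite (removed s)"
  using removed_subset finite_vertices by (rule finite_subset)

lemma nbs_less: "u \<in> nbs v \<Longrightarrow> u < n"
  using nbs_subset by auto

lemma length_adj: "length adj = n"
  using lists by (simp add: adjacency_lists_def)

lemma set_adj: "v < n \<Longrightarrow> set (adj ! v) = nbs v"
  and distinct_adj: "v < n \<Longrightarrow> distinct (adj ! v)"
  using lists by (auto simp: adjacency_lists_def nbs_def)

lemma length_adj_nth: "v < n \<Longrightarrow> length (adj ! v) = card (nbs v)"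
  using set_adj distinct_adj distinct_card by metis

lemma concat_take_Suc:
  assumes "v < n"
  shows "concat (take (Suc v) adj) = concat (take v adj) @ adj ! v"
  using assms length_adj by (simp add: take_Suc_conv_app_nth)

lemma off_Suc: "v < n \<Longrightarrow> off (Suc v) = off v + card (nbs v)"
  by (simp add: off_def input_state_def concat_take_Suc length_adj_nth)

lemma nbr_off:
  assumes v: "v < n" and x: "x < length (adj ! v)"
  shows "nbr (off v + x) = adj ! v ! x"
proof -
  have "concat adj = (concat (take v adj) @ adj ! v) @ concat (drop (Suc v) adj)"
    unfolding concat_take_Suc[OF v, symmetric] by (metis append_take_drop_id concat_append)
  then show ?thesis
    using v x by (simp add: nbr_def off_def input_state_def nth_append)
qed

lemma nth_adj_fresh:
  assumes "v < n" "x < length (adj ! v)"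
  shows "adj ! v ! x \<in> nbs v - set (take x (adj ! v))"
proof -
  have "adj ! v ! x \<in> nbs v"
    using assms set_adj nth_mem by blast
  moreover have "adj ! v ! x \<notin> set (take x (adj ! v))"
    using assms distinct_adj[of v] by (auto simp: in_set_conv_nth nth_eq_iff_index_eq)
  ultimately show ?thesis by blast
qed

lemma wp_for_neighbours:
  assumes s: "input_intact s" "scalars s vertex = v" "v < n" and init: "I {} s"
    and step: "\<And>A u s. input_intact s \<Longrightarrow> scalars s vertex = v \<Longrightarrow> scalars s neighbour = u \<Longrightarrow>
      I A s \<Longrightarrow> u \<in> nbs v - A \<Longrightarrow> A \<subseteq> nbs v \<Longrightarrow>
      wp body s (\<lambda>t s'. I (insert u A) s' \<and> input_intact s' \<and> scalars s' vertex = v \<and>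
        scalars s' position = scalars s position \<and> t \<le> T)"
    and stable: "\<And>A s x k. I A s \<Longrightarrow> x \<in> {position, neighbour} \<Longrightarrow>
      I A (s\<lparr>scalars := (scalars s)(x := k)\<rparr>)"
  shows "wp (for_neighbours body) s (\<lambda>t s'. I (nbs v) s' \<and> input_intact s' \<and>
    scalars s' vertex = v \<and> t \<le> (card (nbs v) + 1) * (T + 20))"
proof -
  let ?xs = "adj ! v" and ?b = "Less (Var position) (Read offsets (Plus (Var vertex) (Num 1)))"
  let ?c = "neighbour ::= Read adjacents (Var position);; body;;
    position ::= Plus (Var position) (Num 1)"
  let ?s0 = "s\<lparr>scalars := (scalars s)(position := off v)\<rparr>"
  define J where "J x s \<longleftrightarrow> input_intact s \<and> scalars s vertex = v \<and>
      scalars s position = off v + x \<and> I (set (take x ?xs)) s" for x s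
  have test: "beval s ?b \<longleftrightarrow> x < length ?xs" if "J x s" for x s
    using that \<open>v < n\<close> by (auto simp: J_def input_intact_def off_Suc length_adj_nth)
  have "wp ?c s (\<lambda>t s'. J (Suc x) s' \<and> t \<le> T + 7)" if "x < length ?xs" "J x s" for x s
  proof -
    let ?u = "?xs ! x" and ?A = "set (take x ?xs)"
    let ?s1 = "s\<lparr>scalars := (scalars s)(neighbour := ?u)\<rparr>"
    have "?A \<subseteq> nbs v"
      using set_adj[OF \<open>v < n\<close>] set_take_subset by metis
    then have body: "wp body ?s1 (\<lambda>t s'. I (insert ?u ?A) s' \<and> input_intact s' \<and>
        scalars s' vertex = v \<and> scalars s' position = off v + x \<and> t \<le> T)"
      using step[of ?s1 ?u ?A] stable nth_adj_fresh[OF \<open>v < n\<close> that(1)] \<open>J x s\<close>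
      by (simp add: J_def input_intact_def)
    have "insert ?u ?A = set (take (Suc x) ?xs)"
      using that by (simp add: take_Suc_conv_app_nth)
    moreover have "eval s (Read adjacents (Var position)) = ?u"
      using \<open>J x s\<close> nbr_off[OF \<open>v < n\<close> that(1)] by (simp add: J_def input_intact_def)
    ultimately show ?thesis
      unfolding wp_Seq wp_Assign
      using body by (auto simp: J_def input_intact_def intro!: stable elim!: wp_mono)
  qed
  moreover have "J 0 ?s0"
    using s init stable by (auto simp: J_def input_intact_def)
  ultimately have "wp (While ?b ?c) ?s0
      (\<lambda>t s'. J (length ?xs) s' \<and> t \<le> (length ?xs + 1) * (1 + bcost ?b + (T + 7)))"
    using test by (intro wp_While_for) auto
  moreover have "eval s (Read offsets (Var vertex)) = off v"
    using s by (simp add: input_intact_def)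
  ultimately show ?thesis
    unfolding for_neighbours_def wp_Seq wp_Assign using \<open>v < n\<close>
    by (auto simp: J_def set_adj length_adj_nth algebra_simps elim!: wp_mono)
qed


section \<open>Removing a vertex\<close>

definition dominators_counted :: "nat set \<Rightarrow> state \<Rightarrow> state \<Rightarrow> bool" where
  "dominators_counted A s s' \<longleftrightarrow> arrays s' = arrays s \<and>
     (\<forall>x\<in>-{dominators, position, neighbour}. scalars s' x = scalars s x) \<and>
     (scalars s' dominators = 0 \<longleftrightarrow> A \<inter> output_set n s = {})"

lemma wp_count_dominators:
  assumes s: "input_intact s" "scalars s vertex = v" "v < n"
  shows "wp count_dominators s
    (\<lambda>t s'. dominators_counted (closed_nbs v) s s' \<and> t \<le> 30 * (card (nbs v) + 1))"
proof -
  let ?body = "dominators ::= Plus (Var dominators) (Read chosen (Var neighbour))"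
  let ?s0 = "s\<lparr>scalars := (scalars s)(dominators := arrays s chosen v)\<rparr>"
  have "wp (for_neighbours ?body) ?s0 (\<lambda>t s'. dominators_counted (insert v (nbs v)) s s' \<and>
      input_intact s' \<and> scalars s' vertex = v \<and> t \<le> (card (nbs v) + 1) * (5 + 20))"
  proof (rule wp_for_neighbours[OF _ _ \<open>v < n\<close>])
    fix A u s'
    assume s': "input_intact s'" "scalars s' vertex = v" "scalars s' neighbour = u"
      "dominators_counted (insert v A) s s'" "u \<in> nbs v - A"
    then have "u < n" using nbs_less by auto
    with s' show "wp ?body s' (\<lambda>t s''. dominators_counted (insert v (insert u A)) s s'' \<and>
        input_intact s'' \<and> scalars s'' vertex = v \<and>
        scalars s'' position = scalars s' position \<and> t \<le> 5)"
      by (auto simp: wp_Assign dominators_counted_def input_intact_def output_set_def)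
  qed (use s in \<open>auto simp: dominators_counted_def input_intact_def output_set_def\<close>)
  then have "wp (for_neighbours ?body) ?s0 (\<lambda>t s'. dominators_counted (closed_nbs v) s s' \<and>
      t + 3 \<le> 30 * (card (nbs v) + 1))"
    by (rule wp_mono) (simp add: closed_nbs_def algebra_simps)
  then show ?thesis
    using s by (auto simp: count_dominators_def wp_Seq wp_Assign elim: wp_mono)
qed

definition neighbours_updated :: "state \<Rightarrow> nat set \<Rightarrow> state \<Rightarrow> bool" where
  "neighbours_updated s A s' \<longleftrightarrow>
     (\<forall>x\<in>-{stack_height, position, neighbour}. scalars s' x = scalars s x) \<and>
     (\<forall>a\<in>-{chosen, removed_degrees, stack}. arrays s' a = arrays s a) \<and>
     scalars s' stack_height = scalars s stack_height + card A \<and>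
     stacked s' = stacked s \<union> A \<and>
     (\<forall>u. arrays s' removed_degrees u = arrays s removed_degrees u + of_bool (u \<in> A)) \<and>
     output_set n s' = output_set n s \<union> (if scalars s dominators = 0 then A - removed s else {})"

lemma wp_update_neighbour:
  assumes s': "neighbours_updated s A s'" and u: "scalars s' neighbour = u" "u < n" "u \<notin> A"
    and "finite A"
  shows "wp update_neighbour s' (\<lambda>t s''. neighbours_updated s (insert u A) s'' \<and>
    (\<forall>x\<in>-{stack_height}. scalars s'' x = scalars s' x) \<and> t \<le> 30)"
proof -
  let ?recruit = "scalars s' dominators = 0 \<and> u \<notin> removed s'"
  define s'' where "s'' = s'\<lparr>
    scalars := (scalars s')(stack_height := scalars s' stack_height + 1),
    arrays := (arrays s')
      (removed_degrees := (arrays s' removed_degrees)(u := arrays s' removed_degrees u + 1),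
       stack := (arrays s' stack)(scalars s' stack_height := u),
       chosen := (if ?recruit then (arrays s' chosen)(u := 1) else arrays s' chosen))\<rparr>"
  have run: "wp update_neighbour s' (\<lambda>t r. r = s'' \<and> t \<le> 30)"
    using u by (auto simp: s''_def update_neighbour_def wp_simps removed_def fun_upd_twist)
  have "stacked s'' = insert u (stacked s')"
    by (auto simp: s''_def stacked_def lessThan_Suc)
  moreover have "output_set n s'' = output_set n s' \<union> (if ?recruit then {u} else {})"
    using \<open>u < n\<close> by (auto simp: s''_def output_set_def)
  moreover have "removed s' = removed s" "scalars s' dominators = scalars s dominators"
    using s' by (simp_all add: neighbours_updated_def removed_def)
  ultimately have "neighbours_updated s (insert u A) s''"
    using s' u \<open>finite A\<close> by (auto simp: neighbours_updated_def s''_def)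
  moreover have "\<forall>x\<in>-{stack_height}. scalars s'' x = scalars s' x"
    by (simp add: s''_def)
  ultimately show ?thesis
    using run by (auto elim!: wp_mono)
qed

lemma wp_for_neighbours_update:
  assumes s: "input_intact s" "scalars s vertex = v" "v < n"
  shows "wp (for_neighbours update_neighbour) s
    (\<lambda>t s'. neighbours_updated s (nbs v) s' \<and> t \<le> 50 * (card (nbs v) + 1))"
proof -
  have "wp (for_neighbours update_neighbour) s (\<lambda>t s'. neighbours_updated s (nbs v) s' \<and>
      input_intact s' \<and> scalars s' vertex = v \<and> t \<le> (card (nbs v) + 1) * (30 + 20))"
  proof (rule wp_for_neighbours[OF s])
    fix A u s'
    assume s': "input_intact s'" "scalars s' vertex = v" "scalars s' neighbour = u"
      "neighbours_updated s A s'" "u \<in> nbs v - A" "A \<subseteq> nbs v"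
    then have "u < n" "finite A"
      using nbs_less finite_subset[OF _ finite_nbs] by auto
    then have "wp update_neighbour s' (\<lambda>t s''. neighbours_updated s (insert u A) s'' \<and>
        (\<forall>x\<in>-{stack_height}. scalars s'' x = scalars s' x) \<and> t \<le> 30)"
      using s' by (intro wp_update_neighbour) auto
    then show "wp update_neighbour s' (\<lambda>t s''. neighbours_updated s (insert u A) s'' \<and>
        input_intact s'' \<and> scalars s'' vertex = v \<and>
        scalars s'' position = scalars s' position \<and> t \<le> 30)"
      by (rule wp_mono) (use s s' in \<open>auto simp: neighbours_updated_def input_intact_def\<close>)
  qed (auto simp: neighbours_updated_def stacked_def output_set_def)
  then show ?thesis
    by (rule wp_mono) (simp add: algebra_simps)
qed

definition marked_removed :: "nat \<Rightarrow> state \<Rightarrow> state \<Rightarrow> bool" where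
  "marked_removed v s s' \<longleftrightarrow>
     scalars s' = (scalars s)(removed_count := scalars s removed_count + 1) \<and>
     (\<forall>a\<in>-{chosen, removal_flags}. arrays s' a = arrays s a) \<and>
     removed s' = insert v (removed s) \<and>
     output_set n s' =
       output_set n s \<union> (if scalars s dominators = 0 \<and> nbs v \<subseteq> removed s then {v} else {})"

lemma wp_mark_removed:
  assumes s: "input_intact s" "scalars s vertex = v" "v < n"
    and deg: "arrays s removed_degrees v = card (nbs v \<inter> removed s)"
  shows "wp mark_removed s (\<lambda>t s'. marked_removed v s s' \<and> t \<le> 50)"
proof -
  let ?alone = "scalars s dominators = 0 \<and> nbs v \<subseteq> removed s"
  define s' where "s' = s\<lparr>
    scalars := (scalars s)(removed_count := scalars s removed_count + 1),
    arrays := (arrays s)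
      (removal_flags := (arrays s removal_flags)(v := 1),
       chosen := (if ?alone then (arrays s chosen)(v := 1) else arrays s chosen))\<rparr>"
  have "card (nbs v) = card (nbs v \<inter> removed s) \<longleftrightarrow> nbs v \<subseteq> removed s"
    by (metis Int_lower1 card_subset_eq finite_nbs inf.absorb_iff1)
  then have run: "wp mark_removed s (\<lambda>t r. r = s' \<and> t \<le> 50)"
    using s deg
    by (auto simp: s'_def mark_removed_def wp_simps input_intact_def off_Suc fun_upd_twist)
  have "removed s' = insert v (removed s)"
    using \<open>v < n\<close> by (auto simp: s'_def removed_def)
  moreover have "output_set n s' = output_set n s \<union> (if ?alone then {v} else {})"
    using \<open>v < n\<close> by (auto simp: s'_def output_set_def)
  ultimately have "marked_removed v s s'"
    by (simp add: marked_removed_def s'_def)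
  then show ?thesis
    using run by (auto elim!: wp_mono)
qed

definition vertex_removed :: "nat \<Rightarrow> state \<Rightarrow> state \<Rightarrow> bool" where
  "vertex_removed v s s' \<longleftrightarrow> input_intact s' \<and>
     scalars s' removed_count = scalars s removed_count + 1 \<and>
     scalars s' stack_height = scalars s stack_height + card (nbs v) \<and>
     scalars s' cursor = scalars s cursor \<and> scalars s' threshold = scalars s threshold \<and>
     removed s' = insert v (removed s) \<and> stacked s' = stacked s \<union> nbs v \<and>
     (\<forall>u. arrays s' removed_degrees u = arrays s removed_degrees u + of_bool (u \<in> nbs v)) \<and>
     output_set n s' = output_set n s \<union>
       (if closed_nbs v \<inter> output_set n s = {} then recruits (removed s) v else {})"

lemma vertex_removed_compose:
  assumes s1: "dominators_counted (closed_nbs v) s s1" and s2: "neighbours_updated s1 (nbs v) s2"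
    and s': "marked_removed v s2 s'" and "input_intact s"
  shows "vertex_removed v s s'"
proof -
  have sets: "removed s1 = removed s" "stacked s1 = stacked s" "output_set n s1 = output_set n s"
      "removed s2 = removed s1" "stacked s' = stacked s2"
    using s1 s2 s'
    by (simp_all add: dominators_counted_def neighbours_updated_def marked_removed_def
        removed_def stacked_def output_set_def)
  have "input_intact s'"
    using s1 s2 s' \<open>input_intact s\<close>
    by (simp add: dominators_counted_def neighbours_updated_def marked_removed_def input_intact_def)
  moreover have "output_set n s' = output_set n s \<union>
      (if closed_nbs v \<inter> output_set n s = {} then recruits (removed s) v else {})"
    using s1 s2 s' sets
    by (auto simp: dominators_counted_def neighbours_updated_def marked_removed_def recruits_def)
  ultimately show ?thesis
    using s1 s2 s' sets
    by (simp add: vertex_removed_def dominators_counted_def neighbours_updated_def marked_removed_def)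
qed

lemma wp_remove_vertex:
  assumes s: "input_intact s" "scalars s vertex = v" "v < n"
    and deg: "arrays s removed_degrees v = card (nbs v \<inter> removed s)"
  shows "wp remove_vertex s (\<lambda>t s'. vertex_removed v s s' \<and> t \<le> 130 * (card (nbs v) + 1))"
proof -
  obtain t1 s1 where run1: "exec count_dominators s t1 s1" "t1 \<le> 30 * (card (nbs v) + 1)"
    and s1: "dominators_counted (closed_nbs v) s s1"
    using wp_count_dominators[OF s] unfolding wp_def by blast
  then have "input_intact s1" "scalars s1 vertex = v"
    using s by (simp_all add: dominators_counted_def input_intact_def)
  then obtain t2 s2 where run2: "exec (for_neighbours update_neighbour) s1 t2 s2"
      "t2 \<le> 50 * (card (nbs v) + 1)"
    and s2: "neighbours_updated s1 (nbs v) s2"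
    using wp_for_neighbours_update[OF _ _ \<open>v < n\<close>] unfolding wp_def by blast
  have "removed s2 = removed s"
    using s1 s2 by (simp add: dominators_counted_def neighbours_updated_def removed_def)
  then have "input_intact s2" "scalars s2 vertex = v"
      "arrays s2 removed_degrees v = card (nbs v \<inter> removed s2)"
    using s deg s1 s2
    by (simp_all add: dominators_counted_def neighbours_updated_def input_intact_def)
  then obtain t3 s' where run3: "exec mark_removed s2 t3 s'" "t3 \<le> 50"
    and s': "marked_removed v s2 s'"
    using wp_mark_removed[OF _ _ \<open>v < n\<close>] unfolding wp_def by blast
  have "exec remove_vertex s (t1 + (t2 + t3)) s'"
    unfolding remove_vertex_def using run1 run2 run3 by (intro exec.Seq)
  moreover have "t1 + (t2 + t3) \<le> 130 * (card (nbs v) + 1)"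
    using run1 run2 run3 by simp
  ultimately show ?thesis
    using vertex_removed_compose[OF s1 s2 s' s(1)] unfolding wp_def by blast
qed

end


section \<open>The peeling loop\<close>

locale degenerate_input = adjacency_input +
  fixes d :: nat
  assumes d_pos: "d \<ge> 1" and degenerate: "degenerate d {..<n} E"
begin

definition counts_correct :: "state \<Rightarrow> bool" where
  "counts_correct s \<longleftrightarrow> scalars s removed_count = card (removed s) \<and>
     (\<forall>u<n. arrays s removed_degrees u = card (nbs u \<inter> removed s))"

text \<open>
  Every vertex that the cursor has passed and that could be removed is on the stack or in \<open>X\<close>.
  Stacked vertices need not be removable; this is tested when they are popped.
\<close>

definition search_inv :: "nat set \<Rightarrow> state \<Rightarrow> bool" where
  "search_inv X s \<longleftrightarrow> scalars s threshold \<le> d \<and> scalars s cursor \<le> n \<and> stacked s \<subseteq> {..<n} \<and>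
     (\<forall>u<scalars s cursor. u \<notin> removed s \<longrightarrow> card (nbs u - removed s) \<le> scalars s threshold \<longrightarrow>
        u \<in> stacked s \<union> X)"

definition peel_inv :: "nat set \<Rightarrow> state \<Rightarrow> bool" where
  "peel_inv X s \<longleftrightarrow> input_intact s \<and> counts_correct s \<and> search_inv X s \<and>
     (\<exists>U. greedy d (removed s) (output_set n s) U)"

text \<open>
  Removing \<open>v\<close> pushes all its neighbours, hence the factor 2 of the degrees; advancing the cursor
  pushes one vertex, hence the factor 2 of the distance to the end.
\<close>

definition work :: "state \<Rightarrow> nat" where
  "work s = 2 * (\<Sum>v\<in>{..<n} - removed s. card (nbs v)) + scalars s stack_height +
     2 * (n - scalars s cursor) + (d - scalars s threshold) * (2 * n + 1)"

lemma card_removed_less_iff: "card (removed s) < n \<longleftrightarrow> removed s \<noteq> {..<n}"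
  using card_mono[OF finite_vertices removed_subset, of s]
    card_subset_eq[OF finite_vertices removed_subset, of s]
  by (metis card_lessThan order_less_le)

lemma removable_iff:
  assumes "peel_inv X s" "scalars s vertex = v" "v < n"
  shows "beval s removable \<longleftrightarrow> v \<notin> removed s \<and> card (nbs v - removed s) \<le> scalars s threshold"
proof -
  have "off (Suc v) = off v + card (nbs v \<inter> removed s) + card (nbs v - removed s)"
    using off_Suc[OF \<open>v < n\<close>] card_Int_Diff[OF finite_nbs, of v "removed s"] by simp
  moreover have "arrays s removal_flags v = 0 \<longleftrightarrow> v \<notin> removed s"
    using \<open>v < n\<close> by (simp add: removed_def)
  ultimately show ?thesis
    using assms by (auto simp: removable_def peel_inv_def input_intact_def counts_correct_def)
qed

lemma counts_correct_vertex_removed: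
  assumes "counts_correct s" "vertex_removed v s s'" "v \<notin> removed s"
  shows "counts_correct s'"
proof -
  have "card (nbs u \<inter> insert v (removed s)) = card (nbs u \<inter> removed s) + of_bool (u \<in> nbs v)" for u
    using \<open>v \<notin> removed s\<close> nbs_sym[of u v] by (simp add: Int_insert_right)
  then show ?thesis
    using assms by (simp add: counts_correct_def vertex_removed_def)
qed

lemma search_inv_vertex_removed:
  assumes "search_inv {v} s" "vertex_removed v s s'"
  shows "search_inv {} s'"
proof -
  have "nbs u - insert v (removed s) = nbs u - removed s" if "u \<notin> nbs v" for u
    using that nbs_sym[of u v] by auto
  then show ?thesis
    using assms nbs_subset by (auto simp: search_inv_def vertex_removed_def)
qed

lemma greedy_vertex_removed:
  assumes "greedy d (removed s) (output_set n s) U" "vertex_removed v s s'"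
    and "v < n" "v \<notin> removed s" "card (nbs v - removed s) \<le> d"
  shows "\<exists>U. greedy d (removed s') (output_set n s') U"
proof (cases "closed_nbs v \<inter> output_set n s = {}")
  case True
  then show ?thesis
    using assms greedy.pick[OF assms(1), of v] by (auto simp: vertex_removed_def)
next
  case False
  then show ?thesis
    using assms greedy.dominated[OF assms(1), of v] by (auto simp: vertex_removed_def)
qed

lemma work_vertex_removed:
  assumes "vertex_removed v s s'" "v < n" "v \<notin> removed s"
  shows "work s = work s' + card (nbs v)"
proof -
  have "(\<Sum>u\<in>{..<n} - removed s. card (nbs u)) =
      card (nbs v) + (\<Sum>u\<in>{..<n} - removed s - {v}. card (nbs u))"
    using assms by (intro sum.remove) auto
  moreover have "{..<n} - removed s - {v} = {..<n} - insert v (removed s)" by auto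
  ultimately show ?thesis
    using assms(1) by (simp add: work_def vertex_removed_def)
qed

lemma wp_remove_vertex_peel:
  assumes inv: "peel_inv {v} s" and v: "scalars s vertex = v" "v < n" and "beval s removable"
  shows "wp remove_vertex s (\<lambda>t s'. peel_inv {} s' \<and> t + 200 * work s' \<le> 200 * work s + 130)"
proof -
  have v_low: "v \<notin> removed s" "card (nbs v - removed s) \<le> d"
    using \<open>beval s removable\<close> removable_iff[OF inv v] inv by (auto simp: peel_inv_def search_inv_def)
  have s: "input_intact s" "counts_correct s" "search_inv {v} s"
    using inv by (simp_all add: peel_inv_def)
  obtain U where U: "greedy d (removed s) (output_set n s) U"
    using inv by (auto simp: peel_inv_def)
  have "wp remove_vertex s (\<lambda>t s'. vertex_removed v s s' \<and> t \<le> 130 * (card (nbs v) + 1))"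
    using s v by (intro wp_remove_vertex) (auto simp: counts_correct_def)
  then show ?thesis
  proof (rule wp_mono, elim conjE)
    fix t s'
    assume s': "vertex_removed v s s'" and t: "t \<le> 130 * (card (nbs v) + 1)"
    have "input_intact s'"
      using s' by (simp add: vertex_removed_def)
    then have "peel_inv {} s'"
      using counts_correct_vertex_removed[OF s(2) s' v_low(1)] search_inv_vertex_removed[OF s(3) s']
        greedy_vertex_removed[OF U s' \<open>v < n\<close> v_low]
      by (simp add: peel_inv_def)
    then show "peel_inv {} s' \<and> t + 200 * work s' \<le> 200 * work s + 130"
      using t work_vertex_removed[OF s' \<open>v < n\<close> v_low(1)] by simp
  qed
qed

lemma wp_pop_vertex:
  assumes "peel_inv {} s" "scalars s stack_height > 0"
  shows "wp pop_vertex s (\<lambda>t s'. peel_inv {scalars s' vertex} s' \<and> scalars s' vertex < n \<and>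
    work s = work s' + 1 \<and> t \<le> 10)"
proof -
  let ?h = "scalars s stack_height - 1"
  let ?v = "arrays s stack ?h"
  define s' where "s' = s\<lparr>scalars := (scalars s)(stack_height := ?h, vertex := ?v)\<rparr>"
  have run: "wp pop_vertex s (\<lambda>t r. r = s' \<and> t \<le> 10)"
    by (simp add: s'_def pop_vertex_def wp_simps)
  have "{..<scalars s stack_height} = insert ?h {..<?h}"
    using assms(2) by auto
  then have "stacked s = insert ?v (stacked s')"
    by (simp add: stacked_def s'_def)
  moreover have "removed s' = removed s" "output_set n s' = output_set n s"
    by (simp_all add: s'_def removed_def output_set_def)
  ultimately have "peel_inv {?v} s'" "?v < n" "work s = work s' + 1"
    using assms
    by (auto simp: peel_inv_def input_intact_def counts_correct_def search_inv_def work_def s'_def)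
  moreover have "scalars s' vertex = ?v"
    by (simp add: s'_def)
  ultimately show ?thesis
    using run by (auto elim!: wp_mono)
qed

lemma wp_push_cursor:
  assumes "peel_inv {} s" "scalars s cursor < n"
  shows "wp push_cursor s (\<lambda>t s'. peel_inv {} s' \<and> work s = work s' + 1 \<and> t \<le> 20)"
proof -
  let ?h = "scalars s stack_height" and ?c = "scalars s cursor"
  define s' where "s' = s\<lparr>scalars := (scalars s)(stack_height := ?h + 1, cursor := ?c + 1),
    arrays := (arrays s)(stack := (arrays s stack)(?h := ?c))\<rparr>"
  have run: "wp push_cursor s (\<lambda>t r. r = s' \<and> t \<le> 20)"
    by (simp add: s'_def push_cursor_def wp_simps)
  have "stacked s' = insert ?c (stacked s)"
    by (auto simp: stacked_def s'_def lessThan_Suc)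
  moreover have "removed s' = removed s" "output_set n s' = output_set n s"
    by (simp_all add: s'_def removed_def output_set_def)
  ultimately have "peel_inv {} s'" "work s = work s' + 1"
    using assms
    by (auto simp: peel_inv_def input_intact_def counts_correct_def search_inv_def work_def s'_def
        less_Suc_eq)
  then show ?thesis
    using run by (auto elim!: wp_mono)
qed

lemma threshold_less_when_search_exhausted:
  assumes "peel_inv {} s" "removed s \<noteq> {..<n}" "scalars s stack_height = 0" "scalars s cursor = n"
  shows "scalars s threshold < d"
proof -
  let ?W = "{..<n} - removed s"
  have "?W \<noteq> {}"
    using assms(2) removed_subset[of s] by blast
  then obtain v where v: "v \<in> ?W" "card (nbs v \<inter> ?W) \<le> d"
    using degenerate_low_degree_vertex[OF degenerate, of ?W] by auto
  have "nbs v \<inter> ?W = nbs v - removed s"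
    using nbs_subset by auto
  moreover have "\<not> card (nbs v - removed s) \<le> scalars s threshold"
    using assms v by (auto simp: peel_inv_def search_inv_def stacked_def)
  ultimately show ?thesis using v by simp
qed

lemma wp_raise_threshold:
  assumes "peel_inv {} s" "scalars s threshold < d" "scalars s cursor = n"
  shows "wp raise_threshold s (\<lambda>t s'. peel_inv {} s' \<and> work s = work s' + 1 \<and> t \<le> 10)"
proof -
  define s' where
    "s' = s\<lparr>scalars := (scalars s)(threshold := scalars s threshold + 1, cursor := 0)\<rparr>"
  have run: "wp raise_threshold s (\<lambda>t r. r = s' \<and> t \<le> 10)"
    by (simp add: s'_def raise_threshold_def wp_simps)
  have "stacked s' = stacked s" "removed s' = removed s" "output_set n s' = output_set n s"
    by (simp_all add: s'_def stacked_def removed_def output_set_def)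
  then have "peel_inv {} s'"
    using assms by (simp add: peel_inv_def input_intact_def counts_correct_def search_inv_def s'_def)
  moreover have "d - scalars s threshold = Suc (d - Suc (scalars s threshold))"
    using assms(2) by simp
  then have "work s = work s' + 1"
    using assms(3) \<open>removed s' = removed s\<close> by (simp add: work_def s'_def)
  ultimately show ?thesis
    using run by (auto elim!: wp_mono)
qed

lemma wp_process_popped:
  assumes inv: "peel_inv {v} s" and v: "scalars s vertex = v" "v < n"
  shows "wp (Cond removable remove_vertex Skip) s
    (\<lambda>t s'. peel_inv {} s' \<and> t + 200 * work s' \<le> 200 * work s + 150)"
proof -
  have "bcost removable = 19"
    by (simp add: removable_def)
  moreover have "wp remove_vertex s (\<lambda>t s'. peel_inv {} s' \<and> t + 200 * work s' \<le> 200 * work s + 130)"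
    if "beval s removable"
    using wp_remove_vertex_peel[OF inv v that] .
  moreover have "peel_inv {} s" if "\<not> beval s removable"
    using inv removable_iff[OF inv v] that by (auto simp: peel_inv_def search_inv_def)
  ultimately show ?thesis
    by (auto simp: wp_Cond wp_Skip elim!: wp_mono)
qed

lemma wp_peel_body:
  assumes inv: "peel_inv {} s" and run: "removed s \<noteq> {..<n}"
  shows "wp peel_body s (\<lambda>t s'. peel_inv {} s' \<and> t + 10 + 200 * work s' \<le> 200 * work s)"
proof -
  have "scalars s vertex_count = n"
    using inv by (simp add: peel_inv_def input_intact_def)
  consider (pop) "scalars s stack_height > 0"
    | (push) "scalars s stack_height = 0" "scalars s cursor < n"
    | (exhausted) "scalars s stack_height = 0" "scalars s cursor = n"
    using inv by (fastforce simp: peel_inv_def search_inv_def)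
  then show ?thesis
  proof cases
    case pop
    have "wp (pop_vertex;; Cond removable remove_vertex Skip) s
        (\<lambda>t s'. peel_inv {} s' \<and> t + 14 + 200 * work s' \<le> 200 * work s)"
      unfolding wp_Seq
    proof (rule wp_mono[OF wp_pop_vertex[OF inv pop]], elim conjE)
      fix t1 :: nat and s1
      assume "peel_inv {scalars s1 vertex} s1" "scalars s1 vertex < n"
        and "work s = work s1 + 1" "t1 \<le> 10"
      then show "wp (Cond removable remove_vertex Skip) s1
          (\<lambda>t s'. peel_inv {} s' \<and> t1 + t + 14 + 200 * work s' \<le> 200 * work s)"
        by (intro wp_mono[OF wp_process_popped[OF _ refl]]) auto
    qed
    then show ?thesis
      using pop by (auto simp: peel_body_def wp_Cond elim: wp_mono)
  next
    case push
    then show ?thesis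
      using wp_push_cursor[OF inv] \<open>scalars s vertex_count = n\<close>
      by (auto simp: peel_body_def wp_Cond elim: wp_mono)
  next
    case exhausted
    then show ?thesis
      using wp_raise_threshold[OF inv threshold_less_when_search_exhausted[OF inv run exhausted]]
        \<open>scalars s vertex_count = n\<close>
      by (auto simp: peel_body_def wp_Cond elim: wp_mono)
  qed
qed

lemma peel_inv_input_state: "peel_inv {} (input_state n adj)"
proof -
  have "removed (input_state n adj) = {}" "output_set n (input_state n adj) = {}"
      "stacked (input_state n adj) = {}"
    by (auto simp: removed_def output_set_def stacked_def input_state_def)
  moreover have "\<exists>U. greedy d {} {} U"
    using greedy.empty by blast
  ultimately show ?thesis
    by (simp add: peel_inv_def input_intact_def counts_correct_def search_inv_def off_def nbr_def)
      (simp add: input_state_def)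
qed

lemma work_input_state: "work (input_state n adj) \<le> 8 * (d * n) + d"
proof -
  have "removed (input_state n adj) = {}"
    by (simp add: removed_def input_state_def)
  then have "work (input_state n adj) = 4 * card E + 2 * n + 2 * (d * n) + d"
    using sum_degree_eq[OF simple] by (simp add: work_def input_state_def card_nbs)
  moreover have "n \<le> d * n"
    using d_pos by simp
  ultimately show ?thesis
    using degenerate_card_edges_le[OF simple degenerate] unfolding card_lessThan by linarith
qed

lemma exec_peel_approximation:
  obtains t s where "exec peel (input_state n adj) t s" "t \<le> 1600 * (d * n) + 200 * d + 4"
    "dominating_set {..<n} E (output_set n s)"
    "card (output_set n s) \<le> d\<^sup>2 * domination_number {..<n} E"
proof -
  let ?b = "Less (Var removed_count) (Var vertex_count)"
  define I where "I k s \<longleftrightarrow> peel_inv {} s \<and> k = 200 * work s" for k s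
  have finished: "beval s ?b \<longleftrightarrow> removed s \<noteq> {..<n}" if "peel_inv {} s" for s
    using that card_removed_less_iff by (simp add: peel_inv_def input_intact_def counts_correct_def)
  have "wp peel_body s (\<lambda>t s'. \<exists>k'. I k' s' \<and> 1 + bcost ?b + t + k' \<le> k)"
    if "I k s" "beval s ?b" for k s
    using that finished by (auto simp: I_def intro!: wp_mono[OF wp_peel_body])
  moreover have "I (200 * work (input_state n adj)) (input_state n adj)"
    using peel_inv_input_state by (simp add: I_def)
  ultimately have "wp peel (input_state n adj) (\<lambda>t s. (\<exists>k. I k s) \<and> \<not> beval s ?b \<and>
      t \<le> 200 * work (input_state n adj) + 1 + bcost ?b)"
    unfolding peel_def by (rule wp_While)
  then obtain t s where s: "exec peel (input_state n adj) t s" "peel_inv {} s" "removed s = {..<n}"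
      "t \<le> 200 * work (input_state n adj) + 4"
    using finished by (auto simp: wp_def I_def)
  then obtain U where "greedy d {..<n} (output_set n s) U"
    by (auto simp: peel_inv_def)
  then show ?thesis
    using that[OF s(1)] s(4) work_input_state greedy_dominating_set
      greedy_card_le_domination_number[OF _ d_pos] by fastforce
qed

end


section \<open>The approximation algorithm\<close>

lemma affine_le_linearithmic:
  assumes "d \<ge> 1" "n \<ge> 2"
  shows "real (a * (d * n) + b * d + c) \<le> real (a + b + c) * (real d * real n * log 2 (real n))"
proof -
  have "d \<le> d * n" "1 \<le> d * n"
    using assms by simp_all
  then have "b * d \<le> b * (d * n)" "c * 1 \<le> c * (d * n)"
    by (simp_all only: mult_le_mono2)
  then have "a * (d * n) + b * d + c \<le> (a + b + c) * (d * n)"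
    unfolding add_mult_distrib by linarith
  then have "real (a * (d * n) + b * d + c) \<le> real (a + b + c) * (real d * real n) * 1"
    by (metis mult.right_neutral of_nat_le_iff of_nat_mult)
  also have "\<dots> \<le> real (a + b + c) * (real d * real n) * log 2 (real n)"
    using assms by (intro mult_left_mono) auto
  finally show ?thesis by (simp add: mult.assoc)
qed

theorem theorem12:
  "\<exists>(prog :: com) (C :: real). \<forall>(n :: nat) (d :: nat) (E :: nat set set) (adj :: nat list list).
     simple_graph {..<n} E \<and> d \<ge> 1 \<and> degenerate d {..<n} E \<and> adjacency_lists n E adj \<longrightarrow>
     (\<exists>t s. exec prog (input_state n adj) t s \<and>
        (n \<ge> 2 \<longrightarrow> real t \<le> C * (real d * real n * log 2 (real n))) \<and>
        dominating_set {..<n} E (output_set n s) \<and>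
        card (output_set n s) \<le> d\<^sup>2 * domination_number {..<n} E)"
proof (intro exI[of _ peel] exI[of _ "1804 :: real"] allI impI)
  fix n d :: nat and E :: "nat set set" and adj :: "nat list list"
  assume "simple_graph {..<n} E \<and> d \<ge> 1 \<and> degenerate d {..<n} E \<and> adjacency_lists n E adj"
  then interpret degenerate_input n E adj d by unfold_locales auto
  obtain t s where s: "exec peel (input_state n adj) t s" "t \<le> 1600 * (d * n) + 200 * d + 4"
      "dominating_set {..<n} E (output_set n s)"
      "card (output_set n s) \<le> d\<^sup>2 * domination_number {..<n} E"
    by (rule exec_peel_approximation)
  have "real t \<le> 1804 * (real d * real n * log 2 (real n))" if "n \<ge> 2"
    using of_nat_mono[OF s(2), where 'a = real]
      affine_le_linearithmic[OF d_pos that, of 1600 200 4] by simp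
  with s show "\<exists>t s. exec peel (input_state n adj) t s \<and>
        (n \<ge> 2 \<longrightarrow> real t \<le> 1804 * (real d * real n * log 2 (real n))) \<and>
        dominating_set {..<n} E (output_set n s) \<and>
        card (output_set n s) \<le> d\<^sup>2 * domination_number {..<n} E"
    by blast
qed

end
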